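(* Let $(X,\tau)$ be a compact sober $T_1$-space. Then there is a maximal compact topology $\tau'$ on $X$ with $\tau\subseteq\tau'$.
   Context: Compactness means that every open cover has a finite subcover; no separation axiom is included. A nonempty subspace $S$ of a topological space is called irreducible if each pair of nonempty open sets of $S$ intersects. A topological space is called sober if every irreducible closed set is the closure of some unique singleton. A compact topology on a set $X$ is called maximal compact if it is not strictly contained in any compact topology on $X$. *)

theory Defs
  imports "HOL-Analysis.Analysis"
begin

definition irreduciblein :: "'a topology \<Rightarrow> 'a set \<Rightarrow> bool" where
  "irreduciblein X S \<longleftrightarrow>
     S \<subseteq> topspace X \<and> S \<noteq> {} \<and>
     (\<forall>U V. openin (subtopology X S) U \<and> openin (subtopology X S) V \<and> U \<noteq> {} \<and> V \<noteq> {}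
        \<longrightarrow> U \<inter> V \<noteq> {})"

definition sober_space :: "'a topology \<Rightarrow> bool" where
  "sober_space X \<longleftrightarrow>
     (\<forall>S. closedin X S \<and> irreduciblein X S
        \<longrightarrow> (\<exists>!x. x \<in> topspace X \<and> S = X closure_of {x}))"

definition topology_subset :: "'a topology \<Rightarrow> 'a topology \<Rightarrow> bool" where
  "topology_subset X Y \<longleftrightarrow> {U. openin X U} \<subseteq> {U. openin Y U}"

definition topology_psubset :: "'a topology \<Rightarrow> 'a topology \<Rightarrow> bool" where
  "topology_psubset X Y \<longleftrightarrow> {U. openin X U} \<subset> {U. openin Y U}"

text \<open>Only topologies on the same underlying set compete, hence the condition on the
  carriers: \<^term>\<open>topspace\<close> may be a proper subset of the type and could otherwise grow.\<close>

definition maximal_compact :: "'a topology \<Rightarrow> bool" where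
  "maximal_compact X \<longleftrightarrow>
     compact_space X \<and>
     \<not> (\<exists>Y. topspace Y = topspace X \<and> compact_space Y \<and> topology_psubset X Y)"

end

theory Submission
  imports Defs
begin

text \<open>
  Zorn's lemma yields the maximal topology as soon as every chain of compact topologies finer
  than \<open>X\<close> has a compact upper bound.  In general the supremum of such a chain is not compact;
  soberness of \<open>X\<close> is what rescues it.

  The supremum has the union of the chain as a subbase.  By Alexander's theorem only covers by
  members of this union matter.  Finitely many of them already lie in a single topology of the
  chain, so the set they leave uncovered is closed, hence compact, in that topology, and
  therefore compact in the coarser topology \<open>X\<close>.  If the cover had no finite subcover, these
  remainders would form a filtered family of nonempty compact sets of \<open>X\<close> with empty
  intersection.

  In a sober \<open>T\<^sub>1\<close>-space there is no such family (lemma \<open>filtered_compactin_Inter_nonempty\<close>, a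
  form of the Hofmann--Mislove theorem): a closed set that is minimal among those meeting
  every member of the family is irreducible, so it is a single point, and that point lies in
  every member.  The remainders need not be closed in \<open>X\<close>, so the usual intersection
  property of compact spaces would not suffice here.
\<close>

text \<open>Soberness provides a generic point, and in a \<open>T\<^sub>1\<close>-space a point is its own closure.\<close>

lemma sober_t1_irreducible_closed_singleton:
  assumes "sober_space X" "t1_space X" "closedin X S" "irreduciblein X S"
  obtains x where "x \<in> topspace X" "S = {x}"
proof -
  obtain x where x: "x \<in> topspace X" "S = X closure_of {x}"
    using assms(1,3,4) unfolding sober_space_def by blast
  with assms(2) have "S = {x}"
    by (simp add: closure_of_closedin t1_space_closedin_singleton)
  with x show thesis
    using that by blast
qed

text \<open>
  Minimal closed sets meeting the whole family are found through their complements: those are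
  the maximal open sets that contain no member of the family.  Compactness of the members
  makes unions of chains of such open sets admissible again, and filteredness makes the
  complement of a maximal one irreducible.
\<close>

lemma filtered_compactin_Inter_nonempty:
  assumes sober: "sober_space X" and t1: "t1_space X"
    and ne: "\<K> \<noteq> {}"
    and K: "\<And>K. K \<in> \<K> \<Longrightarrow> compactin X K" "\<And>K. K \<in> \<K> \<Longrightarrow> K \<noteq> {}"
    and filtered: "\<And>K L. K \<in> \<K> \<Longrightarrow> L \<in> \<K> \<Longrightarrow> \<exists>M\<in>\<K>. M \<subseteq> K \<inter> L"
  shows "\<Inter>\<K> \<noteq> {}"
proof -
  define \<A> where "\<A> = {U. openin X U \<and> (\<forall>K\<in>\<K>. \<not> K \<subseteq> U)}"
  have chain: "\<Union>\<C> \<in> \<A>" if "\<C> \<noteq> {}" and \<C>: "subset.chain \<A> \<C>" for \<C>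
  proof -
    have op: "openin X U" if "U \<in> \<C>" for U
      using \<C> that by (auto simp: \<A>_def subset.chain_def)
    have "\<not> K \<subseteq> \<Union>\<C>" if "K \<in> \<K>" for K
    proof
      assume "K \<subseteq> \<Union>\<C>"
      with op K(1)[OF that] obtain \<F> where "finite \<F>" "\<F> \<subseteq> \<C>" "K \<subseteq> \<Union>\<F>"
        unfolding compactin_def by meson
      moreover from this K(2)[OF that] have "\<F> \<noteq> {}"
        by auto
      moreover have "subset.chain \<A> \<F>"
        using \<C> \<open>\<F> \<subseteq> \<C>\<close> unfolding subset.chain_def by blast
      ultimately have "\<Union>\<F> \<in> \<C>"
        using Union_in_chain[of \<F> \<A>] by blast
      then have "\<Union>\<F> \<in> \<A>"
        using \<C> unfolding subset.chain_def by blast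
      with \<open>K \<subseteq> \<Union>\<F>\<close> that show False
        by (simp add: \<A>_def)
    qed
    with op show ?thesis
      by (auto simp: \<A>_def)
  qed
  have "{} \<in> \<A>"
    using K(2) by (auto simp: \<A>_def)
  then obtain U where U: "U \<in> \<A>" and max: "\<And>V. V \<in> \<A> \<Longrightarrow> U \<subseteq> V \<Longrightarrow> V = U"
    using subset_Zorn_nonempty[of \<A>] chain by blast
  define S where "S = topspace X - U"
  have opU: "openin X U"
    using U by (simp add: \<A>_def)
  have meets: "K \<inter> S \<noteq> {}" if "K \<in> \<K>" for K
    using U that compactin_subset_topspace[OF K(1)[OF that]] by (auto simp: \<A>_def S_def)
  \<comment> \<open>Adding to \<open>U\<close> an open set that meets \<open>S\<close> enlarges it properly, so by maximality the
      union contains a member.\<close>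
  have absorb: "\<exists>K\<in>\<K>. K \<subseteq> U \<union> V" if "openin X V" "V \<inter> S \<noteq> {}" for V
  proof (rule ccontr)
    assume "\<not> ?thesis"
    with that opU have "U \<union> V \<in> \<A>"
      by (auto simp: \<A>_def)
    with max have "U \<union> V = U"
      by blast
    with that show False
      by (auto simp: S_def)
  qed
  have "irreduciblein X S"
    unfolding irreduciblein_def
  proof (intro conjI allI impI)
    show "S \<subseteq> topspace X"
      by (simp add: S_def)
    show "S \<noteq> {}"
      using ne meets by blast
    fix A B
    assume "openin (subtopology X S) A \<and> openin (subtopology X S) B \<and> A \<noteq> {} \<and> B \<noteq> {}"
    then obtain V W where V: "openin X V" "A = V \<inter> S" and W: "openin X W" "B = W \<inter> S"
      and "A \<noteq> {}" "B \<noteq> {}"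
      by (auto simp: openin_subtopology)
    with absorb obtain K L where "K \<in> \<K>" "K \<subseteq> U \<union> V" "L \<in> \<K>" "L \<subseteq> U \<union> W"
      by metis
    moreover from filtered[OF this(1,3)] obtain M where "M \<in> \<K>" "M \<subseteq> K \<inter> L"
      by blast
    ultimately have "M \<inter> S \<subseteq> A \<inter> B"
      using V(2) W(2) by (auto simp: S_def)
    with meets[OF \<open>M \<in> \<K>\<close>] show "A \<inter> B \<noteq> {}"
      by blast
  qed
  moreover have "closedin X S"
    using opU by (auto simp: S_def)
  ultimately obtain x where "S = {x}"
    using sober_t1_irreducible_closed_singleton[OF sober t1] by metis
  with meets have "x \<in> \<Inter>\<K>"
    by blast
  then show ?thesis
    by blast
qed

lemma compactin_coarser_topology:
  assumes "topspace Y = topspace X" "topology_subset X Y" "compactin Y K"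
  shows "compactin X K"
proof -
  have "openin Y U" if "openin X U" for U
    using assms(2) that by (auto simp: topology_subset_def)
  with assms(1,3) show ?thesis
    unfolding compactin_def by simp
qed

text \<open>
  The supremum of the chain is an upper bound of the required kind.  The chain is given by its
  families of open sets, ordered by inclusion, the form in which Zorn's lemma produces it.
\<close>

lemma chain_of_compact_topologies_bounded:
  fixes X :: "'a topology"
  assumes sober: "sober_space X" and t1: "t1_space X"
    and ne: "\<C> \<noteq> {}"
    and chain: "subset.chain
      {{U. openin Y U} | Y. topspace Y = topspace X \<and> compact_space Y \<and> topology_subset X Y} \<C>"
  obtains Z where "topspace Z = topspace X" "compact_space Z" "topology_subset X Z"
    "\<And>\<T>. \<T> \<in> \<C> \<Longrightarrow> \<T> \<subseteq> {U. openin Z U}"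
proof -
  have mem: "\<exists>Y. \<T> = {U. openin Y U} \<and> topspace Y = topspace X \<and> compact_space Y
      \<and> topology_subset X Y" if "\<T> \<in> \<C>" for \<T>
    using chain that by (auto simp: subset.chain_def)
  define Z where "Z = topology (arbitrary union_of
    (finite intersection_of (\<lambda>U. U \<in> \<Union>\<C>) relative_to topspace X))"
  have sub: "U \<subseteq> topspace X" if "U \<in> \<Union>\<C>" for U
    using that mem openin_subset by fastforce
  have top_in: "topspace X \<in> \<Union>\<C>"
    using ne mem by (metis UnionI all_not_in_conv mem_Collect_eq openin_topspace)
  have topZ: "topspace Z = topspace X"
    by (simp add: Z_def)
  have openZ: "openin Z U" if "U \<in> \<Union>\<C>" for U
  proof -
    have "(finite intersection_of (\<lambda>U. U \<in> \<Union>\<C>) relative_to topspace X) (topspace X \<inter> U)"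
      using that by (intro relative_to_inc finite_intersection_of_inc)
    then show ?thesis
      unfolding Z_def openin_subbase using sub[OF that]
      by (metis arbitrary_union_of_inc inf_absorb2)
  qed
  have "compact_space Z"
  proof (rule Alexander_subbase_alt[where \<B> = "\<Union>\<C>" and U = "topspace X"])
    show "topspace X \<subseteq> \<Union>(\<Union>\<C>)"
      using top_in by blast
    fix \<D>
    assume \<D>: "\<D> \<subseteq> \<Union>\<C>" and cov: "topspace X \<subseteq> \<Union>\<D>"
    show "\<exists>\<F>. finite \<F> \<and> \<F> \<subseteq> \<D> \<and> topspace X \<subseteq> \<Union>\<F>"
    proof (rule ccontr)
      assume no_subcover: "\<not> ?thesis"
      define \<K> where "\<K> = {topspace X - \<Union>\<F> | \<F>. finite \<F> \<and> \<F> \<subseteq> \<D>}"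
      have "\<Inter>\<K> \<noteq> {}"
      proof (rule filtered_compactin_Inter_nonempty[OF sober t1])
        show "\<K> \<noteq> {}"
          by (auto simp: \<K>_def)
        fix K
        assume "K \<in> \<K>"
        then obtain \<F> where \<F>: "finite \<F>" "\<F> \<subseteq> \<D>" "K = topspace X - \<Union>\<F>"
          by (auto simp: \<K>_def)
        then show "K \<noteq> {}"
          using no_subcover by auto
        obtain \<T> where \<T>: "\<T> \<in> \<C>" "\<F> \<subseteq> \<T>"
          using finite_subset_Union_chain[OF \<F>(1) _ ne chain] \<F>(2) \<D> by blast
        then obtain Y where Y: "\<T> = {U. openin Y U}" "topspace Y = topspace X"
          "compact_space Y" "topology_subset X Y"
          using mem by blast
        with \<T> have "openin Y (\<Union>\<F>)"
          by (intro openin_Union) blast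
        then have "closedin Y (topspace Y - \<Union>\<F>)"
          by blast
        with \<F>(3) Y(2) have "closedin Y K"
          by simp
        with Y show "compactin X K"
          using closedin_compact_space compactin_coarser_topology by blast
      next
        fix K L
        assume "K \<in> \<K>" "L \<in> \<K>"
        then obtain \<F> \<G> where "finite \<F>" "\<F> \<subseteq> \<D>" "K = topspace X - \<Union>\<F>"
          "finite \<G>" "\<G> \<subseteq> \<D>" "L = topspace X - \<Union>\<G>"
          by (auto simp: \<K>_def)
        then have "K \<inter> L = topspace X - \<Union>(\<F> \<union> \<G>)" "finite (\<F> \<union> \<G>)" "\<F> \<union> \<G> \<subseteq> \<D>"
          by auto
        then have "K \<inter> L \<in> \<K>"
          unfolding \<K>_def by blast
        then show "\<exists>M\<in>\<K>. M \<subseteq> K \<inter> L"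
          by blast
      qed
      then obtain x where x: "\<And>\<F>. finite \<F> \<Longrightarrow> \<F> \<subseteq> \<D> \<Longrightarrow> x \<in> topspace X - \<Union>\<F>"
        by (auto simp: \<K>_def)
      from x[of "{}"] cov obtain U where "U \<in> \<D>" "x \<in> U"
        by auto
      with x[of "{U}"] show False
        by auto
    qed
  qed (simp add: Z_def)
  moreover have "topology_subset X Z"
    using ne mem openZ unfolding topology_subset_def by blast
  ultimately show thesis
    using that topZ openZ by blast
qed

theorem corollary3:
  fixes X :: "'a topology"
  assumes "compact_space X"
    and "sober_space X"
    and "t1_space X"
  shows "\<exists>Y :: 'a topology.
    topspace Y = topspace X \<and> maximal_compact Y \<and> topology_subset X Y"
proof -
  define \<A> where "\<A> = {{U. openin Y U} | Y.
    topspace Y = topspace X \<and> compact_space Y \<and> topology_subset X Y}"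
  have X: "{U. openin X U} \<in> \<A>"
    using assms(1) by (auto simp: \<A>_def topology_subset_def)
  have "\<exists>\<M>\<in>\<A>. \<forall>\<T>\<in>\<A>. \<M> \<subseteq> \<T> \<longrightarrow> \<T> = \<M>"
  proof (rule subset_Zorn)
    fix \<C>
    assume chain: "subset.chain \<A> \<C>"
    show "\<exists>\<M>\<in>\<A>. \<forall>\<T>\<in>\<C>. \<T> \<subseteq> \<M>"
    proof (cases "\<C> = {}")
      case True
      with X show ?thesis
        by blast
    next
      case False
      obtain Z where "topspace Z = topspace X" "compact_space Z" "topology_subset X Z"
        "\<And>\<T>. \<T> \<in> \<C> \<Longrightarrow> \<T> \<subseteq> {U. openin Z U}"
        using chain_of_compact_topologies_bounded[OF assms(2,3) False chain[unfolded \<A>_def]]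
        by blast
      then show ?thesis
        unfolding \<A>_def by blast
    qed
  qed
  then obtain Y where Y: "topspace Y = topspace X" "compact_space Y" "topology_subset X Y"
    and max: "\<forall>\<T>\<in>\<A>. {U. openin Y U} \<subseteq> \<T> \<longrightarrow> \<T> = {U. openin Y U}"
    by (auto simp: \<A>_def)
  have "\<not> topology_psubset Y W" if "topspace W = topspace Y" "compact_space W" for W
  proof
    assume "topology_psubset Y W"
    then have less: "{U. openin Y U} \<subset> {U. openin W U}"
      by (simp add: topology_psubset_def)
    with Y(3) have "topology_subset X W"
      unfolding topology_subset_def by blast
    with Y(1) that have "{U. openin W U} \<in> \<A>"
      unfolding \<A>_def by auto
    with max less show False
      by blast
  qed
  with Y show ?thesis
    unfolding maximal_compact_def by blast
qed

end
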